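(* Let $C_1=C_2=C\in\mathbb{R}^{1\times n}$ and suppose that the noise (co)variances $R_1$ and $R_2$ are not necessarily equal. Let $f:[0,1]\to[0,1]$ be twice differentiable, convex, and decreasing, with $f(0)=1$. Then the base station is optimally located at one of the sensor positions; that is, there is $d^\star\in\{0,1\}$ such that, for every admissible $P_k$ and every $d\in[0,1]$, the expected error covariance $J_{k+1}(d)=\mathbf{E}[P_{k+1}\mid P_k]$ for base station location $d$ satisfies $J_{k+1}(d)\succeq J_{k+1}(d^\star)$. If $R_1\succeq R_2$, then the base station is optimally located at the second sensor, i.e. one may take $d^\star=1$.
   Context: $X\succeq Y$ (Loewner order) means $X-Y$ is positive semidefinite; $M^*$ is the conjugate transpose. Process: $x_{k+1}=Ax_k+w_k$ in $\mathbb{R}^n$, $A$ real $n\times n$, with $w$ independent zero-mean Gaussian of covariance $Q\succeq 0$. Two sensors $s_1,s_2$, located at $0$ and $1$ on the real line, make scalar measurements $y_k^i = C_i x_k + v_k^i$, $i=1,2$, where $C_i\in\mathbb{R}^{1\times n}$ and $v^i$ is independent zero-mean Gaussian noise of variance $R_i\ge 0$; $w,v^1,v^2$ are uncorrelated. A base station at $d\in[0,1]$ runs the Kalman filter on the packets received. At each time the packet from $s_1$ is received with probability $f(d)$ and that from $s_2$ with probability $f(1-d)$, independently. Given the real symmetric positive semidefinite $n \times n$ error covariance $P_k$, if the set of received packets is $\omega\subseteq\{1,2\}$, then $P_{k+1}=AP_kA^*+Q$ if $\omega=\emptyset$, and $P_{k+1} = AP_kA^*+Q-M_\omega$ otherwise,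 where $M_\omega = AP_kF_\omega^*(F_\omega P_kF_\omega^*+G_\omega)^{-1}F_\omega P_kA^*$, with $F_\omega$ the vertical stacking of the $C_j$, $j\in\omega$, and $G_\omega$ the diagonal matrix with entries $R_j$, $j\in\omega$. $P_k$ is called admissible if it is positive semidefinite and all inverses appearing here exist. Hence $$J_{k+1}(d)=\mathbf{E}[P_{k+1}\mid P_k] = AP_kA^*+Q - f(d)f(1-d)M_{\{1,2\}} - f(d)(1-f(1-d))M_{\{1\}} - (1-f(d))f(1-d)M_{\{2\}}.$$ The base station location is optimal if it minimizes $\mathbf{E}[P_{k+1}\mid P_k]$ over $d\in[0,1]$ in the Loewner order, for any $P_k$. *)

theory Defs
  imports "HOL-Analysis.Analysis" "HOL-Probability.Probability"
begin

definition psd :: "real^'n^'n \<Rightarrow> bool" where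
  "psd M \<longleftrightarrow> transpose M = M \<and> (\<forall>x. 0 \<le> x \<bullet> (M *v x))"

definition loewner_ge :: "real^'n^'n \<Rightarrow> real^'n^'n \<Rightarrow> bool" (infix "\<succeq>\<^sub>L" 50) where
  "X \<succeq>\<^sub>L Y \<longleftrightarrow> psd (X - Y)"

text \<open>Vertical stacking of the two row vectors, and the diagonal matrix of the noise
  variances. Numerals of the index type \<^typ>\<open>2\<close> are taken modulo 2, so its two elements are
  1 and 2.\<close>

definition stack :: "real^'n^1 \<Rightarrow> real^'n^1 \<Rightarrow> real^'n^2" where
  "stack C1 C2 = vector [C1 $ 1, C2 $ 1]"

definition diag2 :: "real \<Rightarrow> real \<Rightarrow> real^2^2" where
  "diag2 R1 R2 = (\<chi> i j. if i = j then (if i = 1 then R1 else R2) else 0)"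

definition innov :: "real^'n^'n \<Rightarrow> real^'n^'m \<Rightarrow> real^'m^'m \<Rightarrow> real^'m^'m" where
  "innov P F G = F ** P ** transpose F + G"

definition correction ::
  "real^'n^'n \<Rightarrow> real^'n^'n \<Rightarrow> real^'n^'m \<Rightarrow> real^'m^'m \<Rightarrow> real^'n^'n" where
  "correction A P F G =
     A ** P ** transpose F ** matrix_inv (innov P F G) ** F ** P ** transpose A"

text \<open>The set of received packets is encoded by the pair of indicators of
  \<open>1 \<in> \<omega>\<close> and \<open>2 \<in> \<omega>\<close>. The scalar variances become 1-by-1 matrices via \<^const>\<open>mat\<close>.\<close>

fun next_cov ::
  "real^'n^'n \<Rightarrow> real^'n^'n \<Rightarrow> real^'n^1 \<Rightarrow> real^'n^1 \<Rightarrow> real \<Rightarrow> real \<Rightarrow> real^'n^'n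
    \<Rightarrow> bool \<times> bool \<Rightarrow> real^'n^'n" where
  "next_cov A Q C1 C2 R1 R2 P (False, False) = A ** P ** transpose A + Q"
| "next_cov A Q C1 C2 R1 R2 P (True, False) =
     A ** P ** transpose A + Q - correction A P C1 (mat R1)"
| "next_cov A Q C1 C2 R1 R2 P (False, True) =
     A ** P ** transpose A + Q - correction A P C2 (mat R2)"
| "next_cov A Q C1 C2 R1 R2 P (True, True) =
     A ** P ** transpose A + Q - correction A P (stack C1 C2) (diag2 R1 R2)"

definition admissible ::
  "real^'n^1 \<Rightarrow> real^'n^1 \<Rightarrow> real \<Rightarrow> real \<Rightarrow> real^'n^'n \<Rightarrow> bool" where
  "admissible C1 C2 R1 R2 P \<longleftrightarrow>
     psd P \<and> invertible (innov P C1 (mat R1)) \<and> invertible (innov P C2 (mat R2)) \<and>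
     invertible (innov P (stack C1 C2) (diag2 R1 R2))"

definition packets :: "(real \<Rightarrow> real) \<Rightarrow> real \<Rightarrow> (bool \<times> bool) pmf" where
  "packets f d = pair_pmf (bernoulli_pmf (f d)) (bernoulli_pmf (f (1 - d)))"

definition expected_cov ::
  "real^'n^'n \<Rightarrow> real^'n^'n \<Rightarrow> real^'n^1 \<Rightarrow> real^'n^1 \<Rightarrow> real \<Rightarrow> real
    \<Rightarrow> (real \<Rightarrow> real) \<Rightarrow> real^'n^'n \<Rightarrow> real \<Rightarrow> real^'n^'n" where
  "expected_cov A Q C1 C2 R1 R2 f P d =
     measure_pmf.expectation (packets f d) (next_cov A Q C1 C2 R1 R2 P)"

lemma expected_cov_eq:
  assumes "0 \<le> f d" "f d \<le> 1" "0 \<le> f (1 - d)" "f (1 - d) \<le> 1"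
  shows "expected_cov A Q C1 C2 R1 R2 f P d =
    A ** P ** transpose A + Q
    - (f d * f (1 - d)) *\<^sub>R correction A P (stack C1 C2) (diag2 R1 R2)
    - (f d * (1 - f (1 - d))) *\<^sub>R correction A P C1 (mat R1)
    - ((1 - f d) * f (1 - d)) *\<^sub>R correction A P C2 (mat R2)"
proof -
  have U: "(UNIV :: (bool \<times> bool) set)
      = {(False, False), (True, False), (False, True), (True, True)}"
    by auto
  have "expected_cov A Q C1 C2 R1 R2 f P d =
    (\<Sum>r\<in>UNIV. pmf (packets f d) r *\<^sub>R next_cov A Q C1 C2 R1 R2 P r)"
    unfolding expected_cov_def by (rule integral_measure_pmf) auto
  then show ?thesis
    using assms unfolding U packets_def by (simp add: pmf_pair algebra_simps)
qed

text \<open>The location may not depend on the current covariance \<open>P\<close>.\<close>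

definition optimal_location ::
  "real^'n^'n \<Rightarrow> real^'n^'n \<Rightarrow> real^'n^1 \<Rightarrow> real^'n^1 \<Rightarrow> real \<Rightarrow> real
    \<Rightarrow> (real \<Rightarrow> real) \<Rightarrow> real \<Rightarrow> bool" where
  "optimal_location A Q C1 C2 R1 R2 f d' \<longleftrightarrow>
     d' \<in> {0..1} \<and>
     (\<forall>P. admissible C1 C2 R1 R2 P \<longrightarrow>
        (\<forall>d\<in>{0..1}. expected_cov A Q C1 C2 R1 R2 f P d
            \<succeq>\<^sub>L expected_cov A Q C1 C2 R1 R2 f P d'))"

definition twice_differentiable_on :: "(real \<Rightarrow> real) \<Rightarrow> real set \<Rightarrow> bool" where
  "twice_differentiable_on f S \<longleftrightarrow>
     (\<exists>f'. (\<forall>x\<in>S. (f has_real_derivative f' x) (at x within S)) \<and> f' differentiable_on S)"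

end

theory Submission
  imports Defs
begin

text \<open>Every correction term is a nonnegative multiple of the same positive semidefinite matrix
  \<open>V V\<^sup>T\<close> with \<open>V = A P C\<^sup>T\<close>, so the Loewner comparison reduces to a scalar one. With
  \<open>s = C P C\<^sup>T\<close> the multiples are \<open>a = 1/(s+R1)\<close>, \<open>b = 1/(s+R2)\<close> and
  \<open>c = (R1+R2)/(s R1 + s R2 + R1 R2)\<close>, and \<open>max a b \<le> c \<le> a + b\<close>. The expected gain
  \<open>x y c + x (1-y) a + (1-x) y b\<close> is increasing in \<open>x = f d\<close> and \<open>y = f (1-d)\<close>, so by convexity
  one may replace \<open>f\<close> by its chord. On the chord \<open>x + y\<close> is constant while \<open>x y\<close> is smallest
  at the endpoints, which favours the endpoint at the sensor with the smaller variance.\<close>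

section \<open>Scalar inequalities for the gain\<close>

definition gain :: "real \<Rightarrow> real \<Rightarrow> real \<Rightarrow> real \<Rightarrow> real \<Rightarrow> real" where
  "gain a b c x y = x * y * c + x * (1 - y) * a + (1 - x) * y * b"

text \<open>Exchanging the roles of the two sensors lets the bounds below, proved for
  \<open>a \<le> b\<close>, serve the opposite case too.\<close>

lemma gain_swap: "gain a b c x y = gain b a c y x"
  by (simp add: gain_def)

lemma gain_mono:
  assumes "0 \<le> x" "x \<le> X" "X \<le> 1" "0 \<le> y" "y \<le> Y" "Y \<le> 1"
    and "0 \<le> a" "0 \<le> b" "a \<le> c" "b \<le> c"
  shows "gain a b c x y \<le> gain a b c X Y"
proof -
  \<comment> \<open>The gain is affine in each argument: first \<open>x\<close> moves to
    \<open>X\<close> with \<open>y\<close> fixed, then \<open>y\<close> to \<open>Y\<close> at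
    \<open>X\<close>. Each slope is a convex combination of nonnegative numbers.\<close>
  have "gain a b c X Y - gain a b c x y =
      (X - x) * (y * (c - b) + (1 - y) * a) + (Y - y) * (X * (c - a) + (1 - X) * b)"
    by (simp add: gain_def algebra_simps)
  also have "\<dots> \<ge> 0"
    using assms by (intro add_nonneg_nonneg mult_nonneg_nonneg) auto
  finally show ?thesis by simp
qed

lemma gain_chord_le:
  assumes "0 \<le> t" "t \<le> 1" "p \<le> 1" and "a \<le> b" "c \<le> a + b"
  shows "gain a b c (1 - (1 - p) * t) (1 - (1 - p) * (1 - t)) \<le> gain a b c p 1"
proof -
  \<comment> \<open>Rewrite the gain as \<open>x * a + y * b - x * y * (a + b - c)\<close>. The
    first summand comes from the product of the chord values exceeding \<open>p\<close> by
    \<open>(1 - p)\<^sup>2 * (t * (1 - t))\<close>; the second from shifting probability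
    \<open>(1 - p) * (1 - t)\<close> from sensor 1 to sensor 2.\<close>
  have "gain a b c p 1 - gain a b c (1 - (1 - p) * t) (1 - (1 - p) * (1 - t)) =
      (1 - p)\<^sup>2 * (t * (1 - t)) * (a + b - c) + (1 - p) * (1 - t) * (b - a)"
    by (simp add: gain_def algebra_simps power2_eq_square)
  also have "\<dots> \<ge> 0"
    using assms by (intro add_nonneg_nonneg mult_nonneg_nonneg) auto
  finally show ?thesis by simp
qed

lemma gain_le_endpoint:
  assumes "0 \<le> x" "0 \<le> y" "0 \<le> t" "t \<le> 1" "0 \<le> p" "p \<le> 1"
    and "x \<le> 1 - (1 - p) * t" "y \<le> 1 - (1 - p) * (1 - t)"
    and "0 \<le> a" "a \<le> b" "b \<le> c" "c \<le> a + b"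
  shows "gain a b c x y \<le> gain a b c p 1"
proof -
  have "gain a b c x y \<le> gain a b c (1 - (1 - p) * t) (1 - (1 - p) * (1 - t))"
    using assms by (intro gain_mono) auto
  also have "\<dots> \<le> gain a b c p 1"
    using assms by (intro gain_chord_le) auto
  finally show ?thesis .
qed

lemma convex_on_le_chord:
  fixes f :: "real \<Rightarrow> real"
  assumes "convex_on {0..1} f" "f 0 = 1" "t \<in> {0..1}"
  shows "f t \<le> 1 - (1 - f 1) * t"
  using convex_onD[OF assms(1), of t 0 1] assms(2,3) by (simp add: algebra_simps)

lemma fused_gain_bounds:
  fixes s R1 R2 :: real
  assumes "0 \<le> s" "0 \<le> R1" "0 \<le> R2"
    and "0 < s + R1" "0 < s + R2" "0 < s * R1 + s * R2 + R1 * R2"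
  shows "1 / (s + R1) \<le> (R1 + R2) / (s * R1 + s * R2 + R1 * R2)"
    and "1 / (s + R2) \<le> (R1 + R2) / (s * R1 + s * R2 + R1 * R2)"
    and "(R1 + R2) / (s * R1 + s * R2 + R1 * R2) \<le> 1 / (s + R1) + 1 / (s + R2)"
proof -
  let ?D = "s * R1 + s * R2 + R1 * R2"
  \<comment> \<open>The gaps are \<open>R1 * R1\<close> and \<open>R2 * R2\<close>, since
    \<open>?D\<close> equals \<open>(s + R1) * (s + R2) - s * s\<close>.\<close>
  have "?D \<le> (R1 + R2) * (s + R1)" "?D \<le> (R1 + R2) * (s + R2)"
    using assms by (simp_all add: algebra_simps)
  then show "1 / (s + R1) \<le> (R1 + R2) / ?D" "1 / (s + R2) \<le> (R1 + R2) / ?D"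
    using assms by (simp_all add: frac_le_eq divide_le_0_iff field_simps)
  have "(2 * s + R1 + R2) * ?D - (R1 + R2) * ((s + R1) * (s + R2)) =
      s * s * (R1 + R2) + 2 * s * R1 * R2"
    by (simp add: algebra_simps)
  also have "\<dots> \<ge> 0" using assms by simp
  finally have "(R1 + R2) / ?D \<le> (2 * s + R1 + R2) / ((s + R1) * (s + R2))"
    using assms by (simp add: divide_le_eq le_divide_eq mult.commute)
  also have "\<dots> = 1 / (s + R1) + 1 / (s + R2)"
    using assms by (simp add: add_divide_eq_iff divide_add_eq_iff field_simps)
  finally show "(R1 + R2) / ?D \<le> 1 / (s + R1) + 1 / (s + R2)" .
qed

section \<open>Correction terms as multiples of one Gram matrix\<close>

lemma psd_gram: "psd (V ** transpose V)"
  for V :: "real^'m^'n"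
proof -
  have "x \<bullet> ((V ** transpose V) *v x) = (transpose V *v x) \<bullet> (transpose V *v x)" for x
    by (metis dot_lmul_matrix matrix_vector_mul_assoc transpose_matrix_vector)
  then show ?thesis
    by (simp add: psd_def matrix_transpose_mul)
qed

lemma psd_scaleR: "0 \<le> r \<Longrightarrow> psd M \<Longrightarrow> psd (r *\<^sub>R M)"
  by (simp add: psd_def transpose_scalar scaleR_matrix_vector_assoc[symmetric])

text \<open>With \<open>1\<close> the all-ones vector, the entry sum is the quadratic form of the
  inverse at \<open>1\<close>, so solving one linear system replaces computing the inverse.\<close>

lemma sum_matrix_inv:
  fixes N :: "real^'m^'m"
  assumes "invertible N" "N *v u = 1"
  shows "(\<Sum>i\<in>UNIV. \<Sum>j\<in>UNIV. matrix_inv N $ i $ j) = (\<Sum>i\<in>UNIV. u $ i)"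
proof -
  have left: "matrix_inv N ** N = mat 1"
    using assms(1) unfolding invertible_def matrix_inv_def by (rule someI2_ex) simp
  have "matrix_inv N *v 1 = matrix_inv N *v (N *v u)"
    using assms(2) by simp
  also have "\<dots> = u"
    by (simp add: matrix_vector_mul_assoc left)
  finally have "u $ i = (\<Sum>j\<in>UNIV. matrix_inv N $ i $ j)" for i
    by (auto simp: matrix_vector_mult_def)
  then show ?thesis by simp
qed

text \<open>Equal rows of \<open>F\<close> make all columns of \<open>A ** P ** transpose F\<close>
  equal to the single column of \<open>A ** P ** transpose C\<close>, so each entry of the inverse
  multiplies the same rank-at-most-one matrix.\<close>

lemma correction_equal_rows:
  fixes F :: "real^'n^'m" and C :: "real^'n^1"
  assumes "transpose P = P" "\<And>i. F $ i = C $ 1"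
  shows "correction A P F G =
    (\<Sum>i\<in>UNIV. \<Sum>j\<in>UNIV. matrix_inv (innov P F G) $ i $ j) *\<^sub>R
      ((A ** P ** transpose C) ** transpose (A ** P ** transpose C))"
proof -
  let ?N = "matrix_inv (innov P F G)"
  define U where "U = A ** P ** transpose F"
  define V where "V = A ** P ** transpose C"
  have UV: "U $ k $ i = V $ k $ 1" for k i
    by (simp add: U_def V_def matrix_matrix_mult_def transpose_def assms(2))
  have "correction A P F G = U ** ?N ** transpose U"
    by (simp add: correction_def U_def matrix_transpose_mul matrix_mul_assoc assms(1))
  also have "\<dots> = (\<Sum>i\<in>UNIV. \<Sum>j\<in>UNIV. ?N $ i $ j) *\<^sub>R (V ** transpose V)"
    by (subst sum.swap)
      (simp add: vec_eq_iff matrix_matrix_mult_def transpose_def UV sum_distrib_left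
        sum_distrib_right mult.commute mult.left_commute)
  finally show ?thesis by (simp add: V_def)
qed

lemma innov_equal_rows:
  fixes F :: "real^'n^'m" and C :: "real^'n^1"
  assumes "\<And>i. F $ i = C $ 1"
  shows "innov P F G $ i $ j = (C ** P ** transpose C) $ 1 $ 1 + G $ i $ j"
  by (simp add: innov_def matrix_matrix_mult_def transpose_def assms)

lemma correction_single:
  fixes C :: "real^'n^1"
  assumes "transpose P = P" "invertible (innov P C (mat R))"
  defines "s \<equiv> (C ** P ** transpose C) $ 1 $ 1"
  shows "s + R \<noteq> 0"
    and "correction A P C (mat R) = (1 / (s + R)) *\<^sub>R
      ((A ** P ** transpose C) ** transpose (A ** P ** transpose C))"
proof -
  have rows: "C $ i = C $ 1" for i
    by (rule arg_cong[OF num1_eq1])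
  have N: "innov P C (mat R) $ 1 $ 1 = s + R"
    by (simp add: s_def innov_equal_rows[OF rows] mat_def)
  show ne: "s + R \<noteq> 0"
    using assms(2) N by (simp add: invertible_det_nz det_1)
  have "innov P C (mat R) *v vec (1 / (s + R)) = 1"
    using N ne by (simp add: vec_eq_iff matrix_vector_mult_def)
  from sum_matrix_inv[OF assms(2) this] correction_equal_rows[OF assms(1) rows]
  show "correction A P C (mat R) = (1 / (s + R)) *\<^sub>R
      ((A ** P ** transpose C) ** transpose (A ** P ** transpose C))"
    by simp
qed

lemma correction_both:
  fixes C :: "real^'n^1"
  assumes "transpose P = P" "invertible (innov P (stack C C) (diag2 R1 R2))"
  defines "s \<equiv> (C ** P ** transpose C) $ 1 $ 1"
  defines "D \<equiv> s * R1 + s * R2 + R1 * R2"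
  shows "D \<noteq> 0"
    and "correction A P (stack C C) (diag2 R1 R2) = ((R1 + R2) / D) *\<^sub>R
      ((A ** P ** transpose C) ** transpose (A ** P ** transpose C))"
proof -
  let ?N = "innov P (stack C C) (diag2 R1 R2)"
  have rows: "stack C C $ i = C $ 1" for i
    using exhaust_2[of i] by (auto simp: stack_def)
  have N: "?N $ 1 $ 1 = s + R1" "?N $ 1 $ 2 = s" "?N $ 2 $ 1 = s" "?N $ 2 $ 2 = s + R2"
    by (simp_all add: s_def innov_equal_rows[OF rows] diag2_def)
  have "det ?N = D"
    by (simp add: det_2 N D_def algebra_simps)
  then show ne: "D \<noteq> 0"
    using assms(2) by (simp add: invertible_det_nz)
  \<comment> \<open>The witness is Cramer's rule for the two equations, with determinant
    \<open>D\<close>.\<close>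
  have "?N *v vector [R2 / D, R1 / D] = 1"
    using ne by (simp add: vec_eq_iff forall_2 matrix_vector_mult_def sum_2 N divide_simps)
      (simp add: D_def algebra_simps)
  from sum_matrix_inv[OF assms(2) this] correction_equal_rows[OF assms(1) rows]
  show "correction A P (stack C C) (diag2 R1 R2) = ((R1 + R2) / D) *\<^sub>R
      ((A ** P ** transpose C) ** transpose (A ** P ** transpose C))"
    by (simp add: sum_2 add_divide_distrib add.commute)
qed

section \<open>From expected covariances to the scalar gain\<close>

lemma innovation_variance_nonneg:
  fixes C :: "real^'n^1"
  assumes "psd P"
  shows "0 \<le> (C ** P ** transpose C) $ 1 $ 1"
proof -
  have "(C ** P ** transpose C) $ 1 $ 1 = C $ 1 \<bullet> (P *v (C $ 1))"
    by (simp add: matrix_matrix_mult_def matrix_vector_mult_def transpose_def inner_vec_def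
        sum_distrib_left sum_distrib_right mult.assoc) (subst sum.swap, simp)
  then show ?thesis using assms by (simp add: psd_def)
qed

lemma expected_cov_gain:
  fixes A Q :: "real^'n^'n" and C :: "real^'n^1"
  assumes "admissible C C R1 R2 P" "f ` {0..1} \<subseteq> {0..1}" "d \<in> {0..1}"
  defines "s \<equiv> (C ** P ** transpose C) $ 1 $ 1"
  defines "V \<equiv> A ** P ** transpose C"
  shows "expected_cov A Q C C R1 R2 f P d = A ** P ** transpose A + Q
    - gain (1 / (s + R1)) (1 / (s + R2)) ((R1 + R2) / (s * R1 + s * R2 + R1 * R2))
        (f d) (f (1 - d)) *\<^sub>R (V ** transpose V)"
proof -
  have f: "f d \<in> {0..1}" "f (1 - d) \<in> {0..1}"
    using assms(2,3) by (auto simp: image_subset_iff)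
  have adm: "transpose P = P" "invertible (innov P C (mat R1))" "invertible (innov P C (mat R2))"
    "invertible (innov P (stack C C) (diag2 R1 R2))"
    using assms(1) by (auto simp: admissible_def psd_def)
  show ?thesis
    using f unfolding s_def V_def gain_def
    by (simp add: expected_cov_eq correction_single(2)[OF adm(1,2)]
        correction_single(2)[OF adm(1,3)] correction_both(2)[OF adm(1,4)] scaleR_add_left)
qed

text \<open>The gain is subtracted, so a larger gain means a smaller covariance. The coefficients
  depend on \<open>P\<close> only through \<open>s\<close>; a bound uniform in \<open>s\<close>
  therefore gives one location for every \<open>P\<close>.\<close>

lemma optimal_location_of_gain_le:
  fixes A Q :: "real^'n^'n" and C :: "real^'n^1"
  assumes "0 \<le> R1" "0 \<le> R2" "f ` {0..1} \<subseteq> {0..1}" "d' \<in> {0..1}"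
    and le: "\<And>s d. \<lbrakk>0 \<le> s; 0 < s + R1; 0 < s + R2; 0 < s * R1 + s * R2 + R1 * R2; d \<in> {0..1}\<rbrakk>
      \<Longrightarrow> gain (1 / (s + R1)) (1 / (s + R2)) ((R1 + R2) / (s * R1 + s * R2 + R1 * R2))
            (f d) (f (1 - d))
        \<le> gain (1 / (s + R1)) (1 / (s + R2)) ((R1 + R2) / (s * R1 + s * R2 + R1 * R2))
            (f d') (f (1 - d'))"
  shows "optimal_location A Q C C R1 R2 f d'"
  unfolding optimal_location_def
proof (intro conjI allI impI ballI)
  fix P :: "real^'n^'n" and d :: real
  assume P: "admissible C C R1 R2 P" and d: "d \<in> {0..1}"
  define s where "s = (C ** P ** transpose C) $ 1 $ 1"
  define V where "V = A ** P ** transpose C"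
  let ?g = "\<lambda>d. gain (1 / (s + R1)) (1 / (s + R2)) ((R1 + R2) / (s * R1 + s * R2 + R1 * R2))
            (f d) (f (1 - d))"
  have adm: "psd P" "transpose P = P" "invertible (innov P C (mat R1))"
    "invertible (innov P C (mat R2))" "invertible (innov P (stack C C) (diag2 R1 R2))"
    using P by (auto simp: admissible_def psd_def)
  have s: "0 \<le> s"
    using innovation_variance_nonneg[OF adm(1)] by (simp add: s_def)
  \<comment> \<open>Invertibility excludes zero and nonnegativity then gives strict positivity,
    which covers vanishing noise variances.\<close>
  have "s + R1 \<noteq> 0" "s + R2 \<noteq> 0" "s * R1 + s * R2 + R1 * R2 \<noteq> 0"
    using correction_single(1)[OF adm(2,3)] correction_single(1)[OF adm(2,4)]
      correction_both(1)[OF adm(2,5)] by (simp_all add: s_def)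
  moreover have "0 \<le> s + R1" "0 \<le> s + R2" "0 \<le> s * R1 + s * R2 + R1 * R2"
    using s assms(1,2) by simp_all
  ultimately have "?g d \<le> ?g d'"
    using s d by (intro le) linarith+
  moreover have "expected_cov A Q C C R1 R2 f P d - expected_cov A Q C C R1 R2 f P d' =
      (?g d' - ?g d) *\<^sub>R (V ** transpose V)"
    using expected_cov_gain[OF P assms(3) d] expected_cov_gain[OF P assms(3,4)]
    by (simp add: s_def V_def algebra_simps)
  ultimately show "expected_cov A Q C C R1 R2 f P d \<succeq>\<^sub>L expected_cov A Q C C R1 R2 f P d'"
    by (simp add: loewner_ge_def psd_scaleR psd_gram)
qed (fact assms(4))

theorem corollary2:
  fixes A Q :: "real^'n^'n" and C :: "real^'n^1" and R1 R2 :: real and f :: "real \<Rightarrow> real"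
  assumes "psd Q" and "0 \<le> R1" and "0 \<le> R2"
    and "f ` {0..1} \<subseteq> {0..1}"
    and "twice_differentiable_on f {0..1}"
    and "convex_on {0..1} f"
    and "antimono_on {0..1} f"
    and "f 0 = 1"
  shows "(\<exists>d'\<in>{0, 1}. optimal_location A Q C C R1 R2 f d') \<and>
         (R1 \<ge> R2 \<longrightarrow> optimal_location A Q C C R1 R2 f 1)"
proof -
  have f: "0 \<le> f t" "f t \<le> 1" "f t \<le> 1 - (1 - f 1) * t" if "t \<in> {0..1}" for t
    using assms(4) that convex_on_le_chord[OF assms(6,8) that] by (auto simp: image_subset_iff)
  have f1: "0 \<le> f 1" "f 1 \<le> 1"
    using f[of 1] by auto
  have second: "optimal_location A Q C C R1 R2 f 1" if "R2 \<le> R1"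
  proof (rule optimal_location_of_gain_le[OF assms(2,3,4)])
    fix s d :: real
    assume s: "0 \<le> s" "0 < s + R1" "0 < s + R2" "0 < s * R1 + s * R2 + R1 * R2"
      and d: "d \<in> {0..1}"
    note bounds = fused_gain_bounds[OF s(1) assms(2,3) s(2-)]
    show "gain (1 / (s + R1)) (1 / (s + R2)) ((R1 + R2) / (s * R1 + s * R2 + R1 * R2))
            (f d) (f (1 - d))
        \<le> gain (1 / (s + R1)) (1 / (s + R2)) ((R1 + R2) / (s * R1 + s * R2 + R1 * R2))
            (f 1) (f (1 - 1))"
      \<comment> \<open>Here \<open>R2 \<le> R1\<close> gives \<open>a \<le> b\<close>, and at
        location 1 the reception probabilities are \<open>f 1\<close> and
        \<open>f 0 = 1\<close>.\<close>
      using gain_le_endpoint[of "f d" "f (1 - d)" d "f 1", OF _ _ _ _ f1 _ _ _ _ bounds(2,3)]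
        f[of d] f[of "1 - d"] d s that assms(8) by (simp add: frac_le)
  qed simp
  have first: "optimal_location A Q C C R1 R2 f 0" if "R1 \<le> R2"
  proof (rule optimal_location_of_gain_le[OF assms(2,3,4)])
    fix s d :: real
    assume s: "0 \<le> s" "0 < s + R1" "0 < s + R2" "0 < s * R1 + s * R2 + R1 * R2"
      and d: "d \<in> {0..1}"
    note bounds = fused_gain_bounds[OF s(1) assms(2,3) s(2-)]
    have c: "(R1 + R2) / (s * R1 + s * R2 + R1 * R2) \<le> 1 / (s + R2) + 1 / (s + R1)"
      using bounds(3) by simp
    show "gain (1 / (s + R1)) (1 / (s + R2)) ((R1 + R2) / (s * R1 + s * R2 + R1 * R2))
            (f d) (f (1 - d))
        \<le> gain (1 / (s + R1)) (1 / (s + R2)) ((R1 + R2) / (s * R1 + s * R2 + R1 * R2))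
            (f 0) (f (1 - 0))"
      \<comment> \<open>After the swap sensor 2 comes first, and its distance \<open>1 - d\<close>
        plays the part of \<open>t\<close>.\<close>
      unfolding gain_swap[of "1 / (s + R1)"]
      using gain_le_endpoint[of "f (1 - d)" "f d" "1 - d" "f 1", OF _ _ _ _ f1 _ _ _ _ bounds(1) c]
        f[of d] f[of "1 - d"] d s that assms(8) by (simp add: frac_le)
  qed simp
  show ?thesis
    using first second by (cases "R2 \<le> R1") auto
qed

end
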